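(* Let $q$ be a prime power and let $n,t$ be positive integers with $n/2+1\le t\le n$. Then there exists a family $M\subseteq\mathbb F_q^{n\times n}$ (in fact a linear subspace) with $|M|=q^{n(t-1)}$ such that $\dim\ker(A-B)\le t-2$ for any two distinct $A,B\in M$. In particular, $M$ is $(t-1)$-intersection-free, and it is strictly larger than every $t$-umvirate of $\mathbb F_q^{n\times n}$ (these have size $q^{n^2-nt}$) and than every Frankl family of $\mathbb F_q^{n\times n}$.
   Context: A family $\mathcal F\subseteq\mathbb F_q^{n\times n}$ is $(t-1)$-intersection-free if $\dim\ker(A-B)\ne t-1$ for all $A,B\in\mathcal F$. A $t$-umvirate of $\mathbb F_q^{n\times n}$ is a family $\{A: Av_i=w_i,\ 1\le i\le t\}$ with $v_1,\dots,v_t\in\mathbb F_q^n$ linearly independent and $w_1,\dots,w_t\in\mathbb F_q^n$ arbitrary. A Frankl family (for the parameter $t$) is, for an integer $r\ge0$ with $t+2r\le n$, linearly independent $v_1,\dots,v_{t+2r}\in\mathbb F_q^n$ and arbitrary $w_1,\dots,w_{t+2r}\in\mathbb F_q^n$, the family of all $A\in\mathbb F_q^{n\times n}$ such that $Av_i=w_i$ for at least $t+r$ of the indices $i\in\{1,\dots,t+2r\}$. *)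

theory Defs
  imports "HOL-Analysis.Analysis" "HOL-Number_Theory.Prime_Powers"
begin

definition ker_dim :: "'a::field^'n^'n \<Rightarrow> nat" where
  "ker_dim A = vec.dim {x. A *v x = 0}"

definition mat_scale :: "'a::field \<Rightarrow> 'a^'n^'n \<Rightarrow> 'a^'n^'n" where
  "mat_scale c = map_matrix ((*) c)"

lemma vector_space_mat_scale:
  "vector_space (mat_scale :: 'a::field \<Rightarrow> 'a^'n^'n \<Rightarrow> 'a^'n^'n)"
  by unfold_locales (simp_all add: mat_scale_def map_matrix_def vec_eq_iff algebra_simps)

definition matrix_subspace :: "('a::field^'n^'n) set \<Rightarrow> bool" where
  "matrix_subspace M \<longleftrightarrow> module.subspace mat_scale M"

definition intersection_free :: "nat \<Rightarrow> ('a::field^'n^'n) set \<Rightarrow> bool" where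
  "intersection_free s F \<longleftrightarrow> (\<forall>A\<in>F. \<forall>B\<in>F. ker_dim (A - B) \<noteq> s)"

text \<open>Independence of the indexed family, hence injectivity: independence of the image alone
  would allow repeated vectors.\<close>

definition lin_indep_family :: "nat set \<Rightarrow> (nat \<Rightarrow> 'a::field^'n) \<Rightarrow> bool" where
  "lin_indep_family I v \<longleftrightarrow> inj_on v I \<and> vec.independent (v ` I)"

definition umvirate :: "nat \<Rightarrow> ('a::field^'n^'n) set \<Rightarrow> bool" where
  "umvirate t U \<longleftrightarrow>
     (\<exists>v w. lin_indep_family {1..t} v \<and> U = {A. \<forall>i\<in>{1..t}. A *v v i = w i})"

definition frankl_family :: "nat \<Rightarrow> ('a::field^'n^'n) set \<Rightarrow> bool" where
  "frankl_family t F \<longleftrightarrow>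
     (\<exists>r v w. t + 2 * r \<le> CARD('n) \<and> lin_indep_family {1..t + 2 * r} v \<and>
        F = {A. card {i \<in> {1..t + 2 * r}. A *v v i = w i} \<ge> t + r})"

end

theory Submission
  imports Defs "HOL-Algebra.Algebraic_Closure_Type" "HOL-Number_Theory.Residues"
begin

text \<open>
  The family \<open>M\<close> is a Gabidulin code. Let \<open>K\<close> be the field with \<open>q^n\<close> elements, identified with
  \<open>'a^'n\<close> as a vector space over \<open>'a\<close>. A linearized polynomial
  \<open>a\<^sub>0 x + a\<^sub>1 x^q + \<dots> + a\<^sub>k\<^sub>-\<^sub>1 x^(q^(k-1))\<close> with coefficients in \<open>K\<close> is an \<open>'a\<close>-linear map
  \<open>K \<rightarrow> K\<close>, because the Frobenius map \<open>x \<mapsto> x^q\<close> is additive and fixes \<open>'a\<close>. If the polynomial is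
  not zero, it has at most \<open>q^(k-1)\<close> roots, so its kernel has dimension at most \<open>k - 1 < n\<close>. Hence
  the \<open>q^(n k)\<close> choices of coefficients give different matrices, and these form a linear
  space in which every nonzero matrix has a kernel of dimension at most \<open>k - 1\<close>
  (\<open>maximum_rank_distance_code\<close>). The theorem takes \<open>k = t - 1\<close>.

  The field \<open>K\<close> is the set of fixed points of \<open>x \<mapsto> x^(q^n)\<close> in the algebraic closure of \<open>'a\<close>.
  It has \<open>q^n\<close> elements because \<open>X^(q^n) - X\<close> is separable, its derivative being \<open>-1\<close>
  (\<open>card_frobenius_fixed\<close>).

  The comparisons are counts. Prescribing the values of a matrix on \<open>m\<close> independent vectors leaves
  \<open>n - m\<close> vectors of a basis free, so there are \<open>q^(n(n - m))\<close> such matrices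
  (\<open>card_matrices_with_prescribed_values\<close>). For a \<open>t\<close>-umvirate \<open>m = t\<close>, and \<open>n - t < t - 1\<close>.
  A Frankl family is a union of fewer than \<open>2^(t+2r) \<le> q^n\<close> such sets with \<open>m = t + r\<close>, so it has
  fewer than \<open>q^(n(n - t - r + 1))\<close> elements, and \<open>n - t + 1 \<le> t - 1\<close> by the hypothesis on \<open>t\<close>.
\<close>

section \<open>Counting over a finite field\<close>

lemma (in vector_space) card_span_independent:
  assumes fin: "finite (UNIV :: 'a set)" "finite B" and ind: "independent B"
  shows "card (span B) = CARD('a) ^ card B"
proof -
  let ?f = "\<lambda>u. \<Sum>v\<in>B. scale (u v) v"
  have inj: "inj_on ?f (B \<rightarrow>\<^sub>E UNIV)"
  proof (rule inj_onI)
    fix u w assume uw: "u \<in> B \<rightarrow>\<^sub>E UNIV" "w \<in> B \<rightarrow>\<^sub>E UNIV" "?f u = ?f w"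
    have "(\<Sum>v\<in>B. scale (u v - w v) v) = 0"
      using uw(3) by (simp add: scale_left_diff_distrib sum_subtractf)
    then have "u v - w v = 0" if "v \<in> B" for v
      using independentD[OF ind fin(2) subset_refl, of "\<lambda>v. u v - w v"] that by simp
    then show "u = w"
      using uw(1,2) by (intro PiE_ext) auto
  qed
  have img: "?f ` (B \<rightarrow>\<^sub>E UNIV) = span B"
  proof -
    have "?f u \<in> ?f ` (B \<rightarrow>\<^sub>E UNIV)" for u
      by (rule image_eqI[of _ _ "restrict u B"]) auto
    then show ?thesis
      unfolding span_finite[OF fin(2)] by auto
  qed
  have "card (span B) = card (B \<rightarrow>\<^sub>E (UNIV :: 'a set))"
    using card_image[OF inj] img by simp
  then show ?thesis
    using fin(2) by (simp add: card_PiE)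
qed

lemma CARD_vec: "CARD('a::finite ^ 'n::finite) = CARD('a) ^ CARD('n)"
proof -
  have "bij (vec_nth :: 'a ^ 'n \<Rightarrow> 'n \<Rightarrow> 'a)"
    by (rule o_bij[of vec_lambda]) (auto simp: fun_eq_iff vec_eq_iff)
  then have "CARD('a ^ 'n) = CARD('n \<Rightarrow> 'a)"
    using bij_betw_same_card by blast
  then show ?thesis
    by (simp add: card_fun)
qed

text \<open>Turns a bound on the number of roots into a bound on the dimension of a kernel.\<close>

lemma ker_dim_power_le_card:
  fixes A :: "'a::{field,finite}^'n^'n"
  shows "CARD('a) ^ ker_dim A \<le> card {x. A *v x = 0}"
proof -
  obtain B where B: "B \<subseteq> {x. A *v x = 0}" "vec.independent B" "card B = ker_dim A"
    unfolding ker_dim_def by (metis vec.basis_exists)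
  have "vec.subspace {x. A *v x = 0}"
    by (simp add: vec.subspace_def matrix_vector_right_distrib matrix_vector_mult_scaleR vec.scale)
  then have "vec.span B \<subseteq> {x. A *v x = 0}"
    using B(1) by (metis vec.span_minimal)
  then have "card (vec.span B) \<le> card {x. A *v x = 0}"
    by (intro card_mono) auto
  then show ?thesis
    using vec.card_span_independent[of B] B by simp
qed

section \<open>Matrices with prescribed values\<close>

text \<open>Extend the vectors \<open>v i\<close> to a basis \<open>B\<close>. A matrix is determined by its values on \<open>B\<close>, and these
  values are arbitrary, so restriction to \<open>B\<close> is a bijection onto a product in which the vectors
  \<open>v i\<close> contribute one choice each and the remaining ones \<open>q^n\<close> choices each.\<close>

lemma card_matrices_with_prescribed_values:
  fixes v w :: "nat \<Rightarrow> 'a::{field,finite}^'n"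
  assumes I: "finite I" "lin_indep_family I v"
  shows "card {A :: 'a^'n^'n. \<forall>i\<in>I. A *v v i = w i} = CARD('a) ^ (CARD('n) * (CARD('n) - card I))"
proof -
  define S where "S = v ` I"
  have inj: "inj_on v I" and indS: "vec.independent S"
    using I(2) by (auto simp: lin_indep_family_def S_def)
  obtain B where B: "S \<subseteq> B" "vec.independent B" "UNIV \<subseteq> vec.span B"
    by (rule vec.maximal_independent_subset_extend[OF subset_UNIV indS])
  have "finite B" by simp
  have cardB: "card B = CARD('n)"
    using vec.basis_card_eq_dim[of B UNIV] B by (simp add: card_cart_basis)
  have cardS: "card S = card I"
    by (simp add: S_def card_image inj)
  \<comment> \<open>\<open>T b\<close> is the set of values allowed at the basis vector \<open>b\<close>.\<close>
  define T where "T = (\<lambda>b. if b \<in> S then {w (the_inv_into I v b)} else (UNIV :: ('a^'n) set))"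
  let ?M = "{A :: 'a^'n^'n. \<forall>i\<in>I. A *v v i = w i}"
  let ?r = "\<lambda>A :: 'a^'n^'n. restrict ((*v) A) B"
  have inj_r: "inj_on ?r ?M"
  proof (rule inj_onI)
    fix A A' :: "'a^'n^'n" assume eq: "?r A = ?r A'"
    have "A *v b = A' *v b" if "b \<in> B" for b
      using fun_cong[OF eq, of b] that by simp
    then have "A *v x = A' *v x" for x
      using vec.linear_eq_on[of "(*v) A" "(*v) A'" x B] B(3) by auto
    then show "A = A'"
      by (simp add: matrix_eq)
  qed
  have img_r: "?r ` ?M = Pi\<^sub>E B T"
  proof (intro subset_antisym subsetI)
    fix g assume "g \<in> ?r ` ?M"
    then show "g \<in> Pi\<^sub>E B T"
      by (auto simp: T_def S_def the_inv_into_f_f[OF inj])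
  next
    fix g assume g: "g \<in> Pi\<^sub>E B T"
    obtain h where h: "Vector_Spaces.linear (*s) (*s) h" "\<forall>x\<in>B. h x = g x"
      using vec.linear_independent_extend[OF B(2)] by blast
    have mh: "matrix h *v x = h x" for x
      using matrix_works[OF h(1)] .
    have "matrix h *v v i = w i" if "i \<in> I" for i
    proof -
      have vi: "v i \<in> S" "v i \<in> B"
        using that B(1) by (auto simp: S_def)
      then have "g (v i) \<in> T (v i)"
        using g by auto
      then have "g (v i) = w i"
        using vi(1) that by (simp add: T_def the_inv_into_f_f[OF inj])
      then show ?thesis
        using mh h(2) vi(2) by simp
    qed
    moreover have "?r (matrix h) = g"
      using g h(2) by (intro PiE_ext[of _ B "\<lambda>_. UNIV" ]) (auto simp: mh PiE_iff)
    ultimately show "g \<in> ?r ` ?M"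
      by blast
  qed
  have "card ?M = card (Pi\<^sub>E B T)"
    using card_image[OF inj_r] img_r by simp
  also have "\<dots> = (\<Prod>b\<in>B. card (T b))"
    by (simp add: card_PiE)
  also have "\<dots> = (\<Prod>b\<in>B - S. card (T b))"
    by (rule prod.mono_neutral_right) (auto simp: T_def)
  also have "\<dots> = (\<Prod>b\<in>B - S. CARD('a) ^ CARD('n))"
    by (rule prod.cong) (auto simp: T_def CARD_vec)
  also have "\<dots> = CARD('a) ^ (CARD('n) * (CARD('n) - card I))"
    using B(1) by (simp add: card_Diff_subset cardB cardS power_mult)
  finally show ?thesis .
qed

text \<open>Every member of a Frankl family satisfies all the constraints in some set of \<open>t + r\<close> indices, so the
  family is covered by one set of matrices with prescribed values for each such index set.\<close>

lemma card_frankl_family_le: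
  fixes F :: "('a::{field,finite}^'n^'n) set"
  assumes "frankl_family t F"
  obtains r where "t + 2 * r \<le> CARD('n)"
    and "card F \<le> ((t + 2 * r) choose (t + r)) * CARD('a) ^ (CARD('n) * (CARD('n) - (t + r)))"
proof -
  obtain r v w where r: "t + 2 * r \<le> CARD('n)"
    and v: "lin_indep_family {1..t + 2 * r} v"
    and F: "F = {A :: 'a^'n^'n. card {i \<in> {1..t + 2 * r}. A *v v i = w i} \<ge> t + r}"
    using assms unfolding frankl_family_def by blast
  define \<J> where "\<J> = {J. J \<subseteq> {1..t + 2 * r} \<and> card J = t + r}"
  let ?U = "\<lambda>J. {A :: 'a^'n^'n. \<forall>i\<in>J. A *v v i = w i}"
  have fin\<J>: "finite \<J>"
    by (rule finite_subset[of _ "Pow {1..t + 2 * r}"]) (auto simp: \<J>_def)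
  have "F \<subseteq> (\<Union>J\<in>\<J>. ?U J)"
  proof
    fix A assume "A \<in> F"
    then obtain J where "J \<subseteq> {i \<in> {1..t + 2 * r}. A *v v i = w i}" "card J = t + r"
      unfolding F by (metis (mono_tags, lifting) mem_Collect_eq obtain_subset_with_card_n)
    then have "J \<in> \<J>" "A \<in> ?U J"
      by (auto simp: \<J>_def)
    then show "A \<in> (\<Union>J\<in>\<J>. ?U J)"
      by (rule UN_I)
  qed
  then have "card F \<le> card (\<Union>J\<in>\<J>. ?U J)"
    by (intro card_mono) auto
  also have "\<dots> \<le> (\<Sum>J\<in>\<J>. card (?U J))"
    by (rule card_UN_le[OF fin\<J>])
  also have "\<dots> = (\<Sum>J\<in>\<J>. CARD('a) ^ (CARD('n) * (CARD('n) - (t + r))))"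
  proof (rule sum.cong[OF refl])
    fix J assume "J \<in> \<J>"
    then have J: "J \<subseteq> {1..t + 2 * r}" "card J = t + r"
      by (auto simp: \<J>_def)
    have "lin_indep_family J v"
      using v J(1) unfolding lin_indep_family_def
      by (meson image_mono inj_on_subset vec.independent_mono)
    moreover have "finite J"
      using J(1) finite_subset by blast
    ultimately show "card (?U J) = CARD('a) ^ (CARD('n) * (CARD('n) - (t + r)))"
      using card_matrices_with_prescribed_values[of J v w] J(2) by simp
  qed
  also have "\<dots> = ((t + 2 * r) choose (t + r)) * CARD('a) ^ (CARD('n) * (CARD('n) - (t + r)))"
    using n_subsets[of "{1..t + 2 * r}" "t + r"] by (simp add: \<J>_def)
  finally show thesis
    using that r by blast
qed

section \<open>Roots of polynomials\<close>

text \<open>In the factorization of \<open>p\<close> into linear factors, a factor that occurs twice would give a common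
  root of \<open>p\<close> and its derivative. This holds in every characteristic.\<close>

lemma card_roots_separable:
  fixes p :: "'b::alg_closed_field poly"
  assumes sep: "\<And>x. poly p x = 0 \<Longrightarrow> poly (pderiv p) x \<noteq> 0" and p: "p \<noteq> 0"
  shows "card {x. poly p x = 0} = Polynomial.degree p"
proof -
  obtain A where A: "size A = Polynomial.degree p"
      "p = Polynomial.smult (Polynomial.lead_coeff p) (\<Prod>x\<in>#A. [:-x, 1:])"
    using alg_closed_imp_factorization[OF p] by blast
  have roots: "{x. poly p x = 0} = set_mset A"
    using p by (subst A(2)) (auto simp: poly_prod_mset prod_mset_zero_iff image_iff)
  have "count A x = 1" if x: "x \<in># A" for x
  proof (rule ccontr)
    obtain B where B: "A = add_mset x B"
      using multi_member_split[OF x] by blast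
    assume "count A x \<noteq> 1"
    then have "x \<in># B"
      by (auto simp: B count_eq_zero_iff)
    from multi_member_split[OF this] obtain C where C: "B = add_mset x C"
      by blast
    define s where "s = Polynomial.smult (Polynomial.lead_coeff p) (\<Prod>y\<in>#C. [:-y, 1:])"
    have "Polynomial.smult (Polynomial.lead_coeff p) (\<Prod>y\<in>#A. [:-y, 1:])
        = [:-x, 1:] * ([:-x, 1:] * s)"
      by (simp only: B C s_def image_mset_add_mset prod_mset.add_mset mult_smult_right)
    then have p_eq: "p = [:-x, 1:] * ([:-x, 1:] * s)"
      by (rule trans[OF A(2)])
    have "poly p x = 0" "poly (pderiv p) x = 0"
      by (subst p_eq, simp only: pderiv_mult poly_add poly_mult, simp)+
    then show False
      using sep by blast
  qed
  then have "size A = card (set_mset A)"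
    by (simp add: size_multiset_overloaded_eq)
  then show ?thesis
    using A(1) roots by simp
qed

text \<open>The exponents \<open>q ^ i\<close> are distinct, so the nonzero coefficient cannot be cancelled by another
  term.\<close>

lemma linearized_polynomial_roots:
  fixes a :: "nat \<Rightarrow> 'b::idom"
  assumes q: "2 \<le> q" and j: "j < k" "a j \<noteq> 0"
  shows "finite {x. (\<Sum>i<k. a i * x ^ (q ^ i)) = 0}"
    and "card {x. (\<Sum>i<k. a i * x ^ (q ^ i)) = 0} \<le> q ^ (k - 1)"
proof -
  define p where "p = (\<Sum>i<k. Polynomial.monom (a i) (q ^ i))"
  have "Polynomial.coeff p (q ^ j) = (\<Sum>i<k. if i = j then a j else 0)"
    unfolding p_def coeff_sum using q by (intro sum.cong) auto
  also have "\<dots> = a j"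
    using j(1) by simp
  finally have "p \<noteq> 0"
    using j(2) by auto
  have "Polynomial.degree p \<le> q ^ (k - 1)"
    unfolding p_def
  proof (rule degree_sum_le)
    fix i assume "i \<in> {..<k}"
    then have "q ^ i \<le> q ^ (k - 1)"
      using q by (intro power_increasing) auto
    then show "Polynomial.degree (Polynomial.monom (a i) (q ^ i)) \<le> q ^ (k - 1)"
      using degree_monom_le order_trans by blast
  qed simp
  moreover have "{x. (\<Sum>i<k. a i * x ^ (q ^ i)) = 0} = {x. poly p x = 0}"
    by (simp add: p_def poly_sum poly_monom)
  ultimately show "finite {x. (\<Sum>i<k. a i * x ^ (q ^ i)) = 0}"
    and "card {x. (\<Sum>i<k. a i * x ^ (q ^ i)) = 0} \<le> q ^ (k - 1)"
    using \<open>p \<noteq> 0\<close> poly_roots_finite card_poly_roots_bound[of p] by auto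
qed

section \<open>The extension of degree n of a finite field\<close>

text \<open>Multiplication by a nonzero \<open>x\<close> permutes the nonzero elements, so it preserves their product.\<close>

lemma finite_field_power_CARD:
  fixes x :: "'a::{field,finite}"
  shows "x ^ CARD('a) = x"
proof (cases "x = 0")
  case False
  have "(\<Prod>y\<in>UNIV-{0}. x * y) = (\<Prod>y\<in>UNIV-{0}. y)"
    by (rule prod.reindex_bij_witness[of _ "\<lambda>y. y / x" "\<lambda>y. x * y"]) (use False in auto)
  then have "x ^ (CARD('a) - 1) * \<Prod>(UNIV-{0::'a}) = \<Prod>(UNIV-{0::'a})"
    by (simp add: prod.distrib)
  then have "x ^ (CARD('a) - 1) = 1"
    by simp
  then show ?thesis
    by (metis finite_UNIV_card_ge_0 finite mult.right_neutral power_minus_mult mult.commute)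
qed simp

text \<open>Makes \<open>x \<mapsto> x ^ CARD('a)\<close> an iterate of the Frobenius map of the prime characteristic, hence
  additive.\<close>

lemma CARD_eq_CHAR_power:
  assumes "primepow CARD('a::{field,finite})"
  obtains e where "Factorial_Ring.prime CHAR('a)" "CARD('a) = CHAR('a) ^ e"
proof -
  have prime: "Factorial_Ring.prime CHAR('a)"
    by (simp add: prime_CHAR_semidom finite_imp_CHAR_pos)
  obtain p e where pe: "Factorial_Ring.prime p" "CARD('a) = p ^ e"
    using assms by (auto simp: primepow_def)
  have "CHAR('a) dvd p ^ e"
    using CHAR_dvd_CARD[where 'a = 'a] pe(2) by simp
  then have "CHAR('a) = p"
    using prime pe(1) by (metis prime_dvd_power primes_dvd_imp_eq)
  then show thesis
    using that prime pe by blast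
qed

lemma frobenius_add:
  fixes x y :: "'a::{field,finite} alg_closure"
  assumes "primepow CARD('a)"
  shows "(x + y) ^ (CARD('a) ^ m) = x ^ (CARD('a) ^ m) + y ^ (CARD('a) ^ m)"
proof -
  obtain e where "Factorial_Ring.prime CHAR('a)" "CARD('a) = CHAR('a) ^ e"
    using CARD_eq_CHAR_power assms by blast
  then show ?thesis
    by (intro freshmans_dream'[of _ "e * m"]) (simp_all add: power_mult)
qed

lemma frobenius_to_ac:
  fixes c :: "'a::{field,finite}"
  shows "to_ac c ^ (CARD('a) ^ m) = to_ac c"
proof (induction m)
  case (Suc m)
  have "to_ac c ^ (CARD('a) ^ Suc m) = (to_ac c ^ CARD('a)) ^ (CARD('a) ^ m)"
    by (simp only: power_Suc power_mult)
  also have "to_ac c ^ CARD('a) = to_ac c"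
    by (simp only: finite_field_power_CARD to_ac_power[symmetric])
  finally show ?case
    using Suc by simp
qed simp

text \<open>For \<open>m > 0\<close>, the subfield with \<open>q^m\<close> elements of the algebraic closure, where \<open>q = CARD('a)\<close>.\<close>

definition frobenius_fixed :: "nat \<Rightarrow> 'a::{field,finite} alg_closure set" where
  "frobenius_fixed m = {x. x ^ (CARD('a) ^ m) = x}"

lemma card_frobenius_fixed:
  assumes pp: "primepow CARD('a::{field,finite})" and "m > 0"
  shows "card (frobenius_fixed m :: 'a alg_closure set) = CARD('a) ^ m"
proof -
  define N where "N = CARD('a) ^ m"
  define p :: "'a alg_closure poly" where "p = Polynomial.monom 1 N - Polynomial.monom 1 1"
  have "CARD('a) > 1"
    using pp primepow_gt_Suc_0 by auto
  then have "N > 1"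
    using \<open>m > 0\<close> unfolding N_def by (rule one_less_power)
  have "CHAR('a) dvd N"
    using CHAR_dvd_CARD[where 'a = 'a] \<open>m > 0\<close> unfolding N_def
    by (meson dvd_power dvd_trans)
  then have "of_nat N = (0 :: 'a alg_closure)"
    by (simp add: of_nat_eq_0_iff_char_dvd)
  then have deriv: "pderiv p = -1"
    by (simp add: p_def pderiv_diff pderiv_monom monom_0 one_pCons)
  have deg: "Polynomial.degree p = N"
    using \<open>N > 1\<close> unfolding p_def
    by (intro antisym degree_diff_le le_degree) (simp_all add: degree_monom_eq)
  have "p \<noteq> 0"
    using deg \<open>N > 1\<close> by auto
  have "frobenius_fixed m = {x. poly p x = 0}"
    by (auto simp: frobenius_fixed_def p_def poly_monom N_def)
  then show ?thesis
    using card_roots_separable[of p] \<open>p \<noteq> 0\<close> deriv deg by (simp add: N_def)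
qed

interpretation ac: vector_space "\<lambda>(c :: 'a::field) (x :: 'a alg_closure). to_ac c * x"
  by unfold_locales (simp_all add: algebra_simps)

lemma frobenius_fixed_closed:
  fixes x y :: "'a::{field,finite} alg_closure"
  assumes "primepow CARD('a)"
  shows "0 \<in> (frobenius_fixed m :: 'a alg_closure set)"
    and "x \<in> frobenius_fixed m \<Longrightarrow> y \<in> frobenius_fixed m \<Longrightarrow> x + y \<in> frobenius_fixed m"
    and "x \<in> frobenius_fixed m \<Longrightarrow> y \<in> frobenius_fixed m \<Longrightarrow> x * y \<in> frobenius_fixed m"
    and "to_ac c \<in> (frobenius_fixed m :: 'a alg_closure set)"
  using frobenius_add[OF assms]
  by (auto simp: frobenius_fixed_def power_mult_distrib frobenius_to_ac)

lemma frobenius_fixed_power: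
  fixes x :: "'a::{field,finite} alg_closure"
  shows "x \<in> frobenius_fixed m \<Longrightarrow> x ^ j \<in> frobenius_fixed m"
proof -
  assume x: "x \<in> frobenius_fixed m"
  have "(x ^ j) ^ (CARD('a) ^ m) = (x ^ (CARD('a) ^ m)) ^ j"
    by (simp only: power_mult[symmetric] mult.commute)
  then show "x ^ j \<in> frobenius_fixed m"
    using x by (simp add: frobenius_fixed_def)
qed

text \<open>Both spaces have dimension \<open>n\<close>: a basis of the field of \<open>q^n\<close> elements must have \<open>n\<close> members for
  its span to have the right size.\<close>

lemma vec_iso_frobenius_fixed:
  assumes pp: "primepow CARD('a::{field,finite})"
  obtains \<phi> :: "'a::{field,finite}^'n \<Rightarrow> 'a alg_closure"
  where "\<And>x y. \<phi> (x + y) = \<phi> x + \<phi> y" "\<And>c x. \<phi> (c *s x) = to_ac c * \<phi> x"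
    and "inj \<phi>" "range \<phi> = frobenius_fixed CARD('n)"
proof -
  interpret pair: vector_space_pair "(*s) :: 'a \<Rightarrow> 'a^'n \<Rightarrow> 'a^'n"
      "\<lambda>(c :: 'a) (x :: 'a alg_closure). to_ac c * x" ..
  let ?K = "frobenius_fixed CARD('n) :: 'a alg_closure set"
  have cardK: "card ?K = CARD('a) ^ CARD('n)"
    using card_frobenius_fixed[OF pp] by simp
  have q: "CARD('a) > 1"
    using pp primepow_gt_Suc_0 by auto
  have "finite ?K"
    using cardK q by (intro card_ge_0_finite) simp
  have subK: "ac.subspace ?K"
    unfolding ac.subspace_def using frobenius_fixed_closed[OF pp] by blast
  obtain C where C: "C \<subseteq> ?K" "ac.independent C" "?K \<subseteq> ac.span C" "card C = ac.dim ?K"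
    by (rule ac.basis_exists)
  have finC: "finite C"
    using C(1) \<open>finite ?K\<close> finite_subset by blast
  have "ac.span C = ?K"
    using C(1,3) subK by (simp add: ac.span_minimal subset_antisym)
  then have "CARD('a) ^ card C = CARD('a) ^ CARD('n)"
    using ac.card_span_independent[OF finite finC C(2)] cardK by simp
  then have "ac.dim ?K = CARD('n)"
    using q C(4) by simp
  then have "\<exists>\<phi> :: 'a^'n \<Rightarrow> 'a alg_closure. Vector_Spaces.linear (*s) (\<lambda>c x. to_ac c * x) \<phi> \<and>
      \<phi> ` cart_basis = C \<and> \<phi> ` UNIV = ?K \<and> inj_on \<phi> UNIV"
    using pair.finite_basis_to_basis_subspace_isomorphism[of UNIV ?K cart_basis C] C subK finC
    by (simp add: finite_cart_basis independent_cart_basis span_cart_basis card_cart_basis)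
  then obtain \<phi> :: "'a^'n \<Rightarrow> 'a alg_closure" where \<phi>: "Vector_Spaces.linear (*s) (\<lambda>c x. to_ac c * x) \<phi>"
      "\<phi> ` UNIV = ?K" "inj_on \<phi> UNIV"
    by blast
  interpret lin: Vector_Spaces.linear "(*s)" "\<lambda>c x. to_ac c * x" \<phi>
    by (rule \<phi>(1))
  show thesis
    by (rule that[OF lin.add lin.scale \<phi>(3,2)])
qed

section \<open>The Gabidulin code\<close>

text \<open>The Gabidulin code: \<open>L a\<close> is the linearized polynomial with coefficients \<open>a\<close>, \<open>R a A\<close> says that the
  matrix \<open>A\<close> acts on \<open>'a^'n\<close> as \<open>L a\<close> acts on the field \<open>K\<close>, and \<open>m a\<close> is the matrix with
  \<open>R a (m a)\<close>. Its parameters are the largest possible: a space of matrices whose nonzero elements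
  have rank at least \<open>n - k + 1\<close> has at most \<open>q^(n k)\<close> elements.\<close>

lemma maximum_rank_distance_code:
  assumes pp: "primepow CARD('a::{field,finite})" and k: "k \<ge> 1" "k \<le> CARD('n)"
  obtains M :: "('a::{field,finite}^'n^'n) set"
  where "matrix_subspace M" "card M = CARD('a) ^ (CARD('n) * k)"
    and "\<And>A. A \<in> M \<Longrightarrow> A \<noteq> 0 \<Longrightarrow> ker_dim A \<le> k - 1"
proof -
  let ?q = "CARD('a)"
  let ?K = "frobenius_fixed CARD('n) :: 'a alg_closure set"
  obtain \<phi> :: "'a^'n \<Rightarrow> 'a alg_closure"
    where \<phi>: "\<And>x y. \<phi> (x + y) = \<phi> x + \<phi> y" "\<And>c x. \<phi> (c *s x) = to_ac c * \<phi> x"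
      and inj: "inj \<phi>" and range: "range \<phi> = ?K"
    using vec_iso_frobenius_fixed[OF pp] by blast
  have \<phi>0: "\<phi> 0 = 0"
    using \<phi>(2)[of 0 0] by simp
  have q: "?q \<ge> 2"
    using pp primepow_gt_Suc_0[of ?q] by simp
  have cardK: "card ?K = ?q ^ CARD('n)"
    using card_frobenius_fixed[OF pp] by simp
  have finK: "finite ?K"
    using cardK q by (intro card_ge_0_finite) simp
  define L where "L = (\<lambda>(a :: nat \<Rightarrow> 'a alg_closure) x. \<Sum>i<k. a i * x ^ (?q ^ i))"
  define C where "C = {..<k} \<rightarrow>\<^sub>E ?K"
  define R where "R = (\<lambda>a (A :: 'a^'n^'n). \<forall>x. \<phi> (A *v x) = L a (\<phi> x))"
  have L_add: "L a (x + y) = L a x + L a y" for a x y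
    by (simp add: L_def frobenius_add[OF pp] algebra_simps sum.distrib)
  have L_scale: "L a (to_ac c * x) = to_ac c * L a x" for a c x
    by (simp add: L_def power_mult_distrib frobenius_to_ac algebra_simps sum_distrib_left)
  have L_closed: "L a x \<in> ?K" if "a \<in> C" "x \<in> ?K" for a x
  proof -
    have "(\<Sum>i\<in>I. a i * x ^ (?q ^ i)) \<in> ?K" if "I \<subseteq> {..<k}" for I
      using finite_subset[OF that finite_lessThan] that
    proof (induction I rule: finite_induct)
      case (insert i I)
      then have "a i \<in> ?K"
        using \<open>a \<in> C\<close> by (auto simp: C_def)
      then show ?case
        using insert \<open>x \<in> ?K\<close>
        by (auto intro!: frobenius_fixed_closed(2,3)[OF pp] frobenius_fixed_power)
    qed (simp add: frobenius_fixed_closed[OF pp])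
    then show ?thesis
      by (simp add: L_def)
  qed
  have few_roots: "card {x. L a x = 0} \<le> ?q ^ (k - 1)" "finite {x. L a x = 0}"
    if "j < k" "a j \<noteq> 0" for a j
    using linearized_polynomial_roots[where a = a, OF q that] by (auto simp: L_def)
  have coeffs_unique: "a = b" if ab: "a \<in> C" "b \<in> C" and eq: "\<And>x. x \<in> ?K \<Longrightarrow> L a x = L b x" for a b
  proof (rule ccontr)
    assume "a \<noteq> b"
    then obtain j where j: "j < k" "a j \<noteq> b j"
      using ab PiE_ext[of a _ _ b] unfolding C_def by blast
    \<comment> \<open>The difference would vanish on all of \<open>K\<close>, which has more elements than \<open>q^(k-1)\<close>.\<close>
    let ?d = "\<lambda>i. a i - b i"
    have "L ?d x = L a x - L b x" for x
      by (simp add: L_def algebra_simps sum_subtractf)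
    then have "?K \<subseteq> {x. L ?d x = 0}"
      using eq by auto
    then have "?q ^ CARD('n) \<le> ?q ^ (k - 1)"
      using few_roots[of j ?d] j card_mono cardK by (metis (no_types, lifting) eq_iff_diff_eq_0 order_trans)
    then have "CARD('n) \<le> k - 1"
      using q by simp
    then show False
      using k by linarith
  qed
  have R_unique: "A = B" if "R a A" "R a B" for a A B
    using that inj unfolding R_def matrix_eq by (metis injD)
  have R_exists: "\<exists>A. R a A" if a: "a \<in> C" for a
  proof -
    define g where "g = (\<lambda>x. inv_into UNIV \<phi> (L a (\<phi> x)))"
    have g: "\<phi> (g x) = L a (\<phi> x)" for x
      unfolding g_def using L_closed[OF a] range by (metis f_inv_into_f rangeI)
    have "Vector_Spaces.linear (*s) (*s) g"
    proof unfold_locales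
      show "g (x + y) = g x + g y" for x y
        using inj by (rule injD) (simp add: g \<phi> L_add)
      show "g (c *s x) = c *s g x" for c x
        using inj by (rule injD) (simp add: g \<phi> L_scale)
    qed
    then show ?thesis
      using g matrix_works[of g] unfolding R_def by metis
  qed
  define m where "m = (\<lambda>a. SOME A. R a A)"
  have Rm: "R a (m a)" if "a \<in> C" for a
    unfolding m_def using R_exists[OF that] by (rule someI_ex)
  have m_eqI: "A \<in> m ` C" if "\<And>i. i < k \<Longrightarrow> a i \<in> ?K" "R a A" for a A
  proof -
    \<comment> \<open>Members of \<open>C\<close> are undefined from \<open>k\<close> on, which pointwise sums and multiples need not respect.\<close>
    let ?a = "restrict a {..<k}"
    have "?a \<in> C"
      using that(1) by (auto simp: C_def)
    moreover have "L ?a = L a"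
      by (auto simp: L_def)
    then have "R ?a A"
      using that(2) by (simp add: R_def)
    ultimately have "m ?a = A"
      using R_unique Rm by blast
    then show ?thesis
      using \<open>?a \<in> C\<close> by blast
  qed
  have inj_m: "inj_on m C"
  proof (rule inj_onI)
    fix a b assume ab: "a \<in> C" "b \<in> C" "m a = m b"
    show "a = b"
    proof (rule coeffs_unique[OF ab(1,2)])
      fix x assume "x \<in> ?K"
      then obtain y where "x = \<phi> y"
        using range by blast
      moreover have "\<phi> (m a *v y) = L a (\<phi> y)" "\<phi> (m b *v y) = L b (\<phi> y)"
        using Rm[OF ab(1)] Rm[OF ab(2)] by (simp_all add: R_def)
      ultimately show "L a x = L b x"
        using ab(3) by simp
    qed
  qed
  have CD: "a i \<in> ?K" if "a \<in> C" "i < k" for a i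
    using that by (auto simp: C_def)
  show thesis
  proof (rule that)
    interpret mat: vector_space "mat_scale :: 'a \<Rightarrow> 'a^'n^'n \<Rightarrow> 'a^'n^'n"
      by (rule vector_space_mat_scale)
    have mat_scale: "mat_scale c A *v x = c *s (A *v x)" for c and A :: "'a^'n^'n" and x
      by (simp add: mat_scale_def map_matrix_def matrix_vector_mult_def vec_eq_iff
          sum_distrib_left mult.assoc)
    show "matrix_subspace (m ` C)"
      unfolding matrix_subspace_def mat.subspace_def
    proof (intro conjI allI ballI)
      show "0 \<in> m ` C"
        by (rule m_eqI[of "\<lambda>_. 0"])
          (auto simp: frobenius_fixed_closed[OF pp] R_def L_def \<phi>0)
    next
      fix A B assume "A \<in> m ` C" "B \<in> m ` C"
      then obtain a b where ab: "a \<in> C" "b \<in> C" "R a A" "R b B"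
        using Rm by auto
      have "L (\<lambda>i. a i + b i) x = L a x + L b x" for x
        by (simp add: L_def algebra_simps sum.distrib)
      then show "A + B \<in> m ` C"
        using ab by (intro m_eqI[of "\<lambda>i. a i + b i"])
          (auto simp: frobenius_fixed_closed[OF pp] CD R_def matrix_vector_mult_add_rdistrib \<phi>)
    next
      fix c A assume "A \<in> m ` C"
      then obtain a where a: "a \<in> C" "R a A"
        using Rm by auto
      have "L (\<lambda>i. to_ac c * a i) x = to_ac c * L a x" for x
        by (simp add: L_def algebra_simps sum_distrib_left)
      then show "mat_scale c A \<in> m ` C"
        using a by (intro m_eqI[of "\<lambda>i. to_ac c * a i"])
          (auto simp: frobenius_fixed_closed[OF pp] CD R_def mat_scale \<phi>)
    qed
    show "card (m ` C) = ?q ^ (CARD('n) * k)"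
      using card_image[OF inj_m] by (simp add: C_def card_PiE cardK power_mult)
    fix A assume "A \<in> m ` C" "A \<noteq> 0"
    then obtain a where a: "a \<in> C" "R a A"
      using Rm by auto
    have "\<exists>j<k. a j \<noteq> 0"
    proof (rule ccontr)
      assume "\<not> (\<exists>j<k. a j \<noteq> 0)"
      then have "L a x = 0" for x
        by (auto simp: L_def)
      then have "R a 0"
        by (simp add: R_def \<phi>0)
      then show False
        using R_unique a(2) \<open>A \<noteq> 0\<close> by blast
    qed
    then obtain j where j: "j < k" "a j \<noteq> 0"
      by blast
    have "L a (\<phi> x) = \<phi> (A *v x)" for x
      using a(2) by (simp add: R_def)
    then have "\<phi> ` {x. A *v x = 0} \<subseteq> {x. L a x = 0}"
      using \<phi>0 by auto
    then have "card {x. A *v x = 0} \<le> card {x. L a x = 0}"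
      using few_roots(2)[of j a, OF j] inj by (metis card_inj_on_le inj_on_subset subset_UNIV)
    then have "?q ^ ker_dim A \<le> ?q ^ (k - 1)"
      using ker_dim_power_le_card[of A] few_roots(1)[of j a, OF j] by linarith
    then show "ker_dim A \<le> k - 1"
      using q by simp
  qed
qed

section \<open>The theorem\<close>

theorem mainTheorem3:
  fixes q n t :: nat
  assumes "primepow q"
    and "CARD('a::{field,finite}) = q"
    and "CARD('n::finite) = n"
    and "n \<ge> 1" and "t \<ge> 1"
    and "real n / 2 + 1 \<le> real t" and "t \<le> n"
  shows "\<exists>M :: ('a^'n^'n) set.
    matrix_subspace M \<and>
    card M = q ^ (n * (t - 1)) \<and>
    (\<forall>A\<in>M. \<forall>B\<in>M. A \<noteq> B \<longrightarrow> ker_dim (A - B) \<le> t - 2) \<and>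
    intersection_free (t - 1) M \<and>
    (\<forall>U :: ('a^'n^'n) set. umvirate t U \<longrightarrow> card U = q ^ (n ^ 2 - n * t) \<and> card U < card M) \<and>
    (\<forall>F :: ('a^'n^'n) set. frankl_family t F \<longrightarrow> card F < card M)"
proof -
  have q: "q \<ge> 2"
    using primepow_gt_Suc_0[OF assms(1)] by simp
  have nt: "n + 2 \<le> 2 * t"
    using assms(6) by linarith
  with assms(4) have t: "t \<ge> 2"
    by linarith
  have pp: "primepow CARD('a)" and k: "t - 1 \<ge> 1" "t - 1 \<le> CARD('n)"
    using assms t by auto
  obtain M :: "('a^'n^'n) set"
    where M: "matrix_subspace M" "card M = q ^ (n * (t - 1))"
      and ker: "\<And>A. A \<in> M \<Longrightarrow> A \<noteq> 0 \<Longrightarrow> ker_dim A \<le> t - 1 - 1"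
    by (rule maximum_rank_distance_code[OF pp k, unfolded assms(2,3)]) blast
  interpret mat: vector_space "mat_scale :: 'a \<Rightarrow> 'a^'n^'n \<Rightarrow> 'a^'n^'n"
    by (rule vector_space_mat_scale)
  have dist: "ker_dim (A - B) \<le> t - 2" if "A \<in> M" "B \<in> M" "A \<noteq> B" for A B
    using ker[of "A - B"] mat.subspace_diff[of M A B] M(1) that
    by (simp add: matrix_subspace_def numeral_2_eq_2)
  have ker_0: "ker_dim (0 :: 'a^'n^'n) = n"
    using assms(3) by (simp add: ker_dim_def card_cart_basis)
  have free: "intersection_free (t - 1) M"
    unfolding intersection_free_def
  proof (intro ballI)
    fix A B assume "A \<in> M" "B \<in> M"
    then show "ker_dim (A - B) \<noteq> t - 1"
      using dist[of A B] ker_0 t assms(7) by (cases "A = B") auto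
  qed
  have umv: "card U = q ^ (n ^ 2 - n * t) \<and> card U < card M"
    if U: "umvirate t U" for U :: "('a^'n^'n) set"
  proof -
    obtain v w where v: "lin_indep_family {1..t} v" and U: "U = {A. \<forall>i\<in>{1..t}. A *v v i = w i}"
      using U unfolding umvirate_def by blast
    have card: "card U = q ^ (n * (n - t))"
      using card_matrices_with_prescribed_values[OF _ v, of w] assms unfolding U by simp
    have "n * (n - t) < n * (t - 1)"
      using assms(4) nt t by (intro mult_strict_left_mono) linarith+
    then show ?thesis
      using card M(2) q by (simp add: power2_eq_square diff_mult_distrib2)
  qed
  have frankl: "card F < card M" if F: "frankl_family t F" for F :: "('a^'n^'n) set"
  proof -
    obtain r where r: "t + 2 * r \<le> n"
      and le: "card F \<le> ((t + 2 * r) choose (t + r)) * q ^ (n * (n - (t + r)))"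
      using card_frankl_family_le[OF F] assms by metis
    have "(t + 2 * r) choose (t + r) < 2 ^ (t + 2 * r)"
    proof -
      \<comment> \<open>Strict, because the row of Pascal's triangle also contains the entry at \<open>0 \<noteq> t + r\<close>.\<close>
      have "(\<Sum>i\<in>{0, t + r}. (t + 2 * r) choose i) \<le> (\<Sum>i\<le>t + 2 * r. (t + 2 * r) choose i)"
        by (rule sum_mono2) auto
      then show ?thesis
        using t by (simp add: choose_row_sum)
    qed
    also have "\<dots> \<le> q ^ (t + 2 * r)"
      using q by (rule power_mono) simp
    also have "\<dots> \<le> q ^ n"
      using q r by (intro power_increasing) auto
    finally have "((t + 2 * r) choose (t + r)) * q ^ (n * (n - (t + r)))
        < q ^ n * q ^ (n * (n - (t + r)))"
      using q by (intro mult_strict_right_mono) auto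
    also have "\<dots> = q ^ (n * (1 + (n - (t + r))))"
      by (simp add: power_add)
    also have "\<dots> \<le> q ^ (n * (t - 1))"
      using q nt t r by (intro power_increasing mult_left_mono) linarith+
    finally show ?thesis
      using le M(2) by linarith
  qed
  show ?thesis
    using M dist free umv frankl by blast
qed

end
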